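(* Let $\rho\in\mathbb{C}^{d\times d}$ be a quantum state and let $|v\rangle\sim\mathcal{D}(\rho)$. There exists a universal constant $C$ such that for all integers $h\ge 2$ and all Hermitian matrices $O\in\mathbb{C}^{d\times d}$, \[ \mathbb{E}_{v\sim\mathcal{D}(\rho)}\Big[\big(\langle v|O|v\rangle-\mathbb{E}_{v\sim\mathcal{D}(\rho)}[\langle v|O|v\rangle]\big)^h\Big]\le\Big(\frac{Ch\|O\|_{HS}}{d+1}\Big)^h. \]
   Context: $\mathcal{D}(\rho)$ is the outcome distribution of the uniform POVM applied to $\rho$: the distribution over unit vectors $|v\rangle\in\mathbb{C}^d$ with probability density $d\langle v|\rho|v\rangle\,\mathrm{d}v$, where $\mathrm{d}v$ is the unitarily invariant (Haar) probability measure on the complex unit sphere of $\mathbb{C}^d$. $\|O\|_{HS}=\sqrt{\operatorname{Tr}[O^\dagger O]}$. *)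

theory Defs
  imports "HOL-Probability.Probability"
begin

text \<open>Vectors in C^d are functions nat => complex (coordinates 0..d-1, extensional);
  d x d matrices are functions nat => nat => complex (entries i,j < d).\<close>

definition cvec_space :: "nat \<Rightarrow> (nat \<Rightarrow> complex) measure" where
  "cvec_space d = PiM {..<d} (\<lambda>_. borel)"

definition unit_sphere :: "nat \<Rightarrow> (nat \<Rightarrow> complex) set" where
  "unit_sphere d = {v \<in> space (cvec_space d). (\<Sum>i<d. (cmod (v i))\<^sup>2) = 1}"

definition mat_apply :: "nat \<Rightarrow> (nat \<Rightarrow> nat \<Rightarrow> complex) \<Rightarrow> (nat \<Rightarrow> complex) \<Rightarrow> (nat \<Rightarrow> complex)" where
  "mat_apply d U v = (\<lambda>i. if i < d then (\<Sum>j<d. U i j * v j) else undefined)"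

definition unitary :: "nat \<Rightarrow> (nat \<Rightarrow> nat \<Rightarrow> complex) \<Rightarrow> bool" where
  "unitary d U \<longleftrightarrow> (\<forall>i<d. \<forall>j<d. (\<Sum>k<d. cnj (U k i) * U k j) = (if i = j then 1 else 0))"

definition hermitian :: "nat \<Rightarrow> (nat \<Rightarrow> nat \<Rightarrow> complex) \<Rightarrow> bool" where
  "hermitian d A \<longleftrightarrow> (\<forall>i<d. \<forall>j<d. A i j = cnj (A j i))"

definition qform :: "nat \<Rightarrow> (nat \<Rightarrow> nat \<Rightarrow> complex) \<Rightarrow> (nat \<Rightarrow> complex) \<Rightarrow> complex" where
  "qform d A v = (\<Sum>i<d. \<Sum>j<d. cnj (v i) * A i j * v j)"

definition quantum_state :: "nat \<Rightarrow> (nat \<Rightarrow> nat \<Rightarrow> complex) \<Rightarrow> bool" where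
  "quantum_state d \<rho> \<longleftrightarrow> hermitian d \<rho> \<and> (\<forall>v. 0 \<le> Re (qform d \<rho> v))
      \<and> (\<Sum>i<d. \<rho> i i) = 1"

definition hs_norm :: "nat \<Rightarrow> (nat \<Rightarrow> nat \<Rightarrow> complex) \<Rightarrow> real" where
  "hs_norm d A = sqrt (\<Sum>i<d. \<Sum>j<d. (cmod (A i j))\<^sup>2)"

definition haar_sphere :: "nat \<Rightarrow> (nat \<Rightarrow> complex) measure \<Rightarrow> bool" where
  "haar_sphere d \<mu> \<longleftrightarrow> sets \<mu> = sets (cvec_space d) \<and> prob_space \<mu>
     \<and> emeasure \<mu> (unit_sphere d) = 1
     \<and> (\<forall>U. unitary d U \<longrightarrow> distr \<mu> (cvec_space d) (mat_apply d U) = \<mu>)"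

text \<open>Outcome distribution D(rho) of the uniform POVM: density d <v|rho|v> w.r.t. Haar.\<close>
definition povm_dist :: "nat \<Rightarrow> (nat \<Rightarrow> complex) measure \<Rightarrow> (nat \<Rightarrow> nat \<Rightarrow> complex) \<Rightarrow> (nat \<Rightarrow> complex) measure" where
  "povm_dist d \<mu> \<rho> = density \<mu> (\<lambda>v. ennreal (real d * Re (qform d \<rho> v)))"

end

theory Submission
  imports Defs
begin

text \<open>Differentiating the invariance of the measure under unitary one-parameter groups gives a
  Wick-type recursion for the mixed moments
  \<open>T(A\<^sub>0, \<dots>, A\<^sub>n\<^sub>-\<^sub>1) = \<integral> \<langle>v|A\<^sub>0|v\<rangle> \<cdots> \<langle>v|A\<^sub>n\<^sub>-\<^sub>1|v\<rangle> dv\<close>, namely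
  \<open>(d + n) T(A\<^sub>0, \<dots>, A\<^sub>n) = tr A\<^sub>n \<cdot> T(A\<^sub>0, \<dots>, A\<^sub>n\<^sub>-\<^sub>1) + \<Sum>\<^sub>k T(A\<^sub>0, \<dots>, A\<^sub>k A\<^sub>n, \<dots>, A\<^sub>n\<^sub>-\<^sub>1)\<close>.
  If every factor has trace and Hilbert-Schmidt norm at most \<open>w\<^sub>l\<close>, a property that products inherit, the
  recursion yields \<open>|T| \<le> n! \<Prod>\<^sub>l w\<^sub>l / (d (d+1) \<cdots> (d+n-1))\<close>. On the sphere \<open>\<langle>v|O|v\<rangle>\<close> differs from
  the form of the traceless part of \<open>O\<close> by a constant, and for traceless \<open>O\<close> the bound applies with
  \<open>h\<close> factors \<open>O\<close> and one factor \<open>\<rho>\<close>; the centred moments follow by binomial expansion.\<close>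

section \<open>Forms, products and traces of matrices\<close>

definition sesq :: "nat \<Rightarrow> (nat \<Rightarrow> nat \<Rightarrow> complex) \<Rightarrow> (nat \<Rightarrow> complex) \<Rightarrow> (nat \<Rightarrow> complex) \<Rightarrow> complex" where
  "sesq d A u v = (\<Sum>i<d. \<Sum>j<d. cnj (u i) * A i j * v j)"

definition cinner :: "nat \<Rightarrow> (nat \<Rightarrow> complex) \<Rightarrow> (nat \<Rightarrow> complex) \<Rightarrow> complex" where
  "cinner d u v = (\<Sum>i<d. cnj (u i) * v i)"

definition mat_mult :: "nat \<Rightarrow> (nat \<Rightarrow> nat \<Rightarrow> complex) \<Rightarrow> (nat \<Rightarrow> nat \<Rightarrow> complex) \<Rightarrow> nat \<Rightarrow> nat \<Rightarrow> complex" where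
  "mat_mult d A B = (\<lambda>i j. \<Sum>k<d. A i k * B k j)"

definition mat_trace :: "nat \<Rightarrow> (nat \<Rightarrow> nat \<Rightarrow> complex) \<Rightarrow> complex" where
  "mat_trace d A = (\<Sum>i<d. A i i)"

lemma qform_eq_sesq: "qform d A v = sesq d A v v"
  by (simp add: qform_def sesq_def)

text \<open>The hypothesis is restricted to coordinates below \<open>d\<close> because it is applied
  to \<open>mat_apply\<close>, which is \<open>undefined\<close> beyond them.\<close>

lemma sesq_add_scaled:
  assumes "\<And>i. i < d \<Longrightarrow> w i = v i + c * u i"
  shows "sesq d A w w = sesq d A v v + c * sesq d A v u + cnj c * sesq d A u v
           + c * cnj c * sesq d A u u"
proof -
  have "sesq d A w w = (\<Sum>i<d. \<Sum>j<d. cnj (v i) * A i j * v j + c * (cnj (v i) * A i j * u j)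
      + cnj c * (cnj (u i) * A i j * v j) + c * cnj c * (cnj (u i) * A i j * u j))"
    unfolding sesq_def by (intro sum.cong refl) (simp add: assms algebra_simps)
  then show ?thesis
    unfolding sesq_def by (simp add: sum.distrib sum_distrib_left)
qed

section \<open>Difference quotients of finite products\<close>

text \<open>Leibniz rule along a sequence: \<open>r n\<close> plays the role of the reciprocal step,
  so \<open>l k\<close> is the derivative of the \<open>k\<close>-th factor at
  \<open>y k\<close>.\<close>

lemma prod_diff_quotient_tendsto:
  fixes x :: "nat \<Rightarrow> 'k \<Rightarrow> complex" and r :: "nat \<Rightarrow> complex"
  assumes "finite I"
    and "\<And>k. k \<in> I \<Longrightarrow> (\<lambda>n. r n * (x n k - y k)) \<longlonglongrightarrow> l k"
    and "\<And>k. k \<in> I \<Longrightarrow> (\<lambda>n. x n k) \<longlonglongrightarrow> y k"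
  shows "(\<lambda>n. r n * ((\<Prod>k\<in>I. x n k) - (\<Prod>k\<in>I. y k)))
           \<longlonglongrightarrow> (\<Sum>k\<in>I. l k * (\<Prod>j\<in>I - {k}. y j))"
  using assms
proof (induction I rule: finite_induct)
  case empty
  then show ?case by simp
next
  case (insert a F)
  have IH: "(\<lambda>n. r n * (prod (x n) F - prod y F)) \<longlonglongrightarrow> (\<Sum>k\<in>F. l k * prod y (F - {k}))"
    using insert by auto
  have "(\<lambda>n. r n * (x n a - y a) * prod (x n) F + y a * (r n * (prod (x n) F - prod y F)))
    \<longlonglongrightarrow> l a * prod y F + y a * (\<Sum>k\<in>F. l k * prod y (F - {k}))"
    by (intro tendsto_add tendsto_mult tendsto_const tendsto_prod IH) (auto simp: insert.prems)
  moreover have "r n * (x n a - y a) * prod (x n) F + y a * (r n * (prod (x n) F - prod y F))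
      = r n * (prod (x n) (insert a F) - prod y (insert a F))" for n
    using insert.hyps by (simp add: algebra_simps)
  moreover have "l a * prod y F + y a * (\<Sum>k\<in>F. l k * prod y (F - {k}))
     = (\<Sum>k\<in>insert a F. l k * prod y (insert a F - {k}))"
  proof -
    have "prod y (insert a F - {k}) = y a * prod y (F - {k})" if "k \<in> F" for k
    proof -
      have "insert a F - {k} = insert a (F - {k})" using that insert.hyps by auto
      then show ?thesis using insert.hyps by simp
    qed
    moreover have "insert a F - {a} = F" using insert.hyps by auto
    ultimately show ?thesis
      using insert.hyps by (simp add: sum_distrib_left mult_ac)
  qed
  ultimately show ?case by simp
qed

text \<open>The telescoping bound \<open>norm_prod_diff\<close> wants factors in the unit ball,
  hence the rescaling by \<open>K\<close>. The result provides a dominating constant for difference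
  quotients of products.\<close>

lemma norm_prod_diff_le:
  fixes x y :: "'k \<Rightarrow> complex"
  assumes "\<And>k. k \<in> I \<Longrightarrow> norm (x k) \<le> K" "\<And>k. k \<in> I \<Longrightarrow> norm (y k) \<le> K" "1 \<le> K"
  shows "norm (prod x I - prod y I) \<le> K ^ card I * (\<Sum>k\<in>I. norm (x k - y k))"
proof -
  have K: "K > 0" using assms(3) by simp
  have "norm ((\<Prod>k\<in>I. x k / K) - (\<Prod>k\<in>I. y k / K)) \<le> (\<Sum>k\<in>I. norm (x k / K - y k / K))"
    by (rule norm_prod_diff) (use assms K in \<open>auto simp: norm_divide divide_le_eq\<close>)
  also have "\<dots> = (\<Sum>k\<in>I. norm (x k - y k)) / K"
    using K by (simp add: diff_divide_distrib[symmetric] norm_divide sum_divide_distrib)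
  also have "\<dots> \<le> (\<Sum>k\<in>I. norm (x k - y k))"
    using divide_left_mono[of 1 K "\<Sum>k\<in>I. norm (x k - y k)"] assms(3) by (simp add: sum_nonneg)
  finally have "norm ((prod x I - prod y I) / K ^ card I) \<le> (\<Sum>k\<in>I. norm (x k - y k))"
    by (simp add: prod_dividef diff_divide_distrib)
  then show ?thesis
    using K by (simp add: norm_divide norm_power divide_le_eq mult.commute)
qed

section \<open>Rank-one unitary perturbations of the identity\<close>

lemma sum_mult_cnj_eq_1:
  assumes "(\<Sum>i<d. (cmod (u i))\<^sup>2) = 1"
  shows "(\<Sum>i<d. u i * cnj (u i)) = 1"
  unfolding complex_norm_square[symmetric] of_real_power[symmetric] of_real_sum[symmetric] assms
  by simp

text \<open>The matrix multiplies the unit vector \<open>u\<close> by \<open>1 + e\<close> and fixes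
  its orthogonal complement, so it is unitary once \<open>1 + e\<close> has modulus one.\<close>

lemma unitary_rank_one_perturbation:
  assumes u: "(\<Sum>i<d. (cmod (u i))\<^sup>2) = 1" and e: "cmod (1 + e) = 1"
  shows "unitary d (\<lambda>i j. (if i = j then 1 else 0) + e * u i * cnj (u j))"
  unfolding unitary_def
proof (intro allI impI)
  fix i j assume ij: "i < d" "j < d"
  note uu = sum_mult_cnj_eq_1[OF u]
  have "(1 + e) * cnj (1 + e) = 1"
    unfolding complex_norm_square[symmetric] e by simp
  then have ee: "e + cnj e + e * cnj e = 0"
    by (simp add: algebra_simps)
  have "(\<Sum>k<d. cnj ((if k = i then 1 else 0) + e * u k * cnj (u i)) *
          ((if k = j then 1 else 0) + e * u k * cnj (u j)))
      = (\<Sum>k<d. (if k = i then (if i = j then 1 else 0) + e * u i * cnj (u j) else 0)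
          + (if k = j then cnj e * cnj (u j) * u i else 0)
          + (e * cnj e * u i * cnj (u j)) * (u k * cnj (u k)))"
    by (intro sum.cong refl) (auto simp: algebra_simps)
  also have "\<dots> = (if i = j then 1 else 0) + (e + cnj e + e * cnj e) * (u i * cnj (u j))"
    unfolding sum.distrib sum_distrib_left[symmetric] uu using ij by (simp add: algebra_simps)
  finally show "(\<Sum>k<d. cnj ((if k = i then 1 else 0) + e * u k * cnj (u i)) *
          ((if k = j then 1 else 0) + e * u k * cnj (u j))) = (if i = j then 1 else 0)"
    by (simp add: ee)
qed

lemma mat_apply_rank_one_perturbation:
  assumes "i < d"
  shows "mat_apply d (\<lambda>i j. (if i = j then 1 else 0) + e * u i * cnj (u j)) v i
          = v i + e * cinner d u v * u i"
proof -
  have "(\<Sum>j<d. ((if i = j then 1 else 0) + e * u i * cnj (u j)) * v j)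
     = (\<Sum>j<d. (if j = i then v i else 0) + e * u i * (cnj (u j) * v j))"
    by (intro sum.cong refl) (auto simp: algebra_simps)
  then show ?thesis
    using assms by (simp add: mat_apply_def cinner_def sum.distrib flip: sum_distrib_left)
qed

section \<open>Polarisation of quadratic forms\<close>

lemma double_sum_two_point:
  fixes f :: "nat \<Rightarrow> nat \<Rightarrow> 'a::comm_monoid_add"
  assumes "i \<noteq> j" "i < d" "j < d" "\<And>k l. k \<notin> {i, j} \<or> l \<notin> {i, j} \<Longrightarrow> f k l = 0"
  shows "(\<Sum>k<d. \<Sum>l<d. f k l) = f i i + f i j + f j i + f j j"
proof -
  have "(\<Sum>k<d. \<Sum>l<d. f k l) = (\<Sum>k<d. \<Sum>l\<in>{i, j}. f k l)"
    using assms by (intro sum.cong refl sum.mono_neutral_right) auto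
  also have "\<dots> = (\<Sum>k\<in>{i, j}. \<Sum>l\<in>{i, j}. f k l)"
    using assms by (intro sum.mono_neutral_right) auto
  finally show ?thesis using assms(1) by (simp add: add.assoc)
qed

text \<open>Basis vectors kill the diagonal. A vector with entries \<open>1\<close> at
  \<open>i\<close> and \<open>z\<close> at \<open>j\<close> then leaves
  \<open>cnj z * \<phi> i j + z * \<phi> j i = 0\<close>, and the choices \<open>z = 1\<close> and
  \<open>z = \<i>\<close> separate the two unknowns.\<close>

lemma quadratic_form_zero_imp_zero:
  fixes \<phi> :: "nat \<Rightarrow> nat \<Rightarrow> complex"
  assumes zero: "\<And>u. (\<Sum>i<d. \<Sum>j<d. u i * cnj (u j) * \<phi> i j) = 0" and "i < d" "j < d"
  shows "\<phi> i j = 0"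
proof -
  define Q where "Q u = (\<Sum>i<d. \<Sum>j<d. u i * cnj (u j) * \<phi> i j)" for u :: "nat \<Rightarrow> complex"
  have diag: "\<phi> a a = 0" if "a < d" for a
  proof -
    have "Q (\<lambda>i. if i = a then 1 else 0) = (\<Sum>i<d. \<Sum>j<d. if j = a then (if i = a then \<phi> a a else 0) else 0)"
      unfolding Q_def by (intro sum.cong refl) auto
    also have "\<dots> = \<phi> a a" using that by simp
    finally show ?thesis using zero unfolding Q_def by simp
  qed
  show ?thesis
  proof (cases "i = j")
    case True then show ?thesis using diag assms by simp
  next
    case False
    have Q2: "cnj z * \<phi> i j + z * \<phi> j i = 0" for z
    proof -
      define u where "u k = (if k = i then 1 else if k = j then z else 0)" for k
      have "Q u = u i * cnj (u i) * \<phi> i i + u i * cnj (u j) * \<phi> i j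
          + u j * cnj (u i) * \<phi> j i + u j * cnj (u j) * \<phi> j j"
        unfolding Q_def using False assms(2,3) by (intro double_sum_two_point) (auto simp: u_def)
      then show ?thesis
        using zero[of u] False assms(2,3) by (simp add: Q_def u_def diag)
    qed
    from Q2[of 1] Q2[of \<i>] show ?thesis
      by (auto simp: complex_eq_iff)
  qed
qed

section \<open>Integrability of functions bounded on the sphere\<close>

locale haar_sphere_measure =
  fixes d :: nat and \<mu> :: "(nat \<Rightarrow> complex) measure"
  assumes haar: "haar_sphere d \<mu>"
begin

lemma sets_eq: "sets \<mu> = sets (cvec_space d)"
  using haar by (simp add: haar_sphere_def)

sublocale prob_space \<mu>
  using haar by (simp add: haar_sphere_def)

lemma coordinate_measurable [measurable]:
  "i < d \<Longrightarrow> (\<lambda>v. v i) \<in> borel_measurable \<mu>"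
  unfolding measurable_cong_sets[OF sets_eq refl] cvec_space_def
  by (rule measurable_component_singleton) simp

lemma AE_unit_sphere: "AE v in \<mu>. v \<in> unit_sphere d"
proof -
  have "unit_sphere d = {v \<in> space \<mu>. (\<Sum>i<d. (cmod (v i))\<^sup>2) = 1}"
    using sets_eq_imp_space_eq[OF sets_eq] by (simp add: unit_sphere_def)
  also have "\<dots> \<in> sets \<mu>"
    by measurable
  finally have "unit_sphere d \<in> sets \<mu>" .
  moreover have "prob (unit_sphere d) = 1"
    using haar by (simp add: haar_sphere_def measure_def)
  ultimately show ?thesis
    using AE_prob_1 by blast
qed

text \<open>In dimension zero the sphere equation reads \<open>0 = 1\<close>, so the sphere is empty
  and cannot have mass one.\<close>

lemma dim_pos: "d > 0"
proof (rule ccontr)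
  assume "\<not> d > 0"
  then have "unit_sphere d = {}" by (simp add: unit_sphere_def)
  then show False using haar by (simp add: haar_sphere_def)
qed

text \<open>Polynomials in the coordinates and their conjugates are unbounded on the whole space,
  but the measure lives on the sphere. Asking for a bound only there gives a class that is closed
  under the ring operations and consists of integrable functions.\<close>

definition sphere_bounded :: "((nat \<Rightarrow> complex) \<Rightarrow> complex) \<Rightarrow> bool" where
  "sphere_bounded f \<longleftrightarrow> f \<in> borel_measurable \<mu> \<and> (\<exists>B. \<forall>v\<in>unit_sphere d. cmod (f v) \<le> B)"

lemma sphere_bounded_integrable: "sphere_bounded f \<Longrightarrow> integrable \<mu> f"
  using AE_unit_sphere
  by (auto simp: sphere_bounded_def intro!: integrable_const_bound)

lemma unit_sphere_coordinate_le_1: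
  assumes "v \<in> unit_sphere d" "i < d"
  shows "cmod (v i) \<le> 1"
proof -
  have "(cmod (v i))\<^sup>2 \<le> (\<Sum>i<d. (cmod (v i))\<^sup>2)"
    using assms(2) by (intro member_le_sum) auto
  then show ?thesis
    using assms(1) by (simp add: unit_sphere_def power_le_one_iff)
qed

lemma sphere_bounded_const: "sphere_bounded (\<lambda>v. c)"
  by (auto simp: sphere_bounded_def)

lemma sphere_bounded_coordinate: "i < d \<Longrightarrow> sphere_bounded (\<lambda>v. v i)"
  using unit_sphere_coordinate_le_1 by (auto simp: sphere_bounded_def)

lemma sphere_bounded_cnj: "sphere_bounded f \<Longrightarrow> sphere_bounded (\<lambda>v. cnj (f v))"
  unfolding sphere_bounded_def
  by (auto intro!: borel_measurable_continuous_on[of cnj] continuous_intros)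

lemma sphere_bounded_add:
  "sphere_bounded f \<Longrightarrow> sphere_bounded g \<Longrightarrow> sphere_bounded (\<lambda>v. f v + g v)"
  unfolding sphere_bounded_def
  by (auto intro: order_trans[OF norm_triangle_ineq add_mono])

lemma sphere_bounded_diff:
  "sphere_bounded f \<Longrightarrow> sphere_bounded g \<Longrightarrow> sphere_bounded (\<lambda>v. f v - g v)"
  unfolding sphere_bounded_def
  by (auto intro: order_trans[OF norm_triangle_ineq4 add_mono])

lemma sphere_bounded_mult:
  assumes "sphere_bounded f" "sphere_bounded g"
  shows "sphere_bounded (\<lambda>v. f v * g v)"
proof -
  from assms obtain B C where
    "\<forall>v\<in>unit_sphere d. cmod (f v) \<le> B" "\<forall>v\<in>unit_sphere d. cmod (g v) \<le> C"
    by (auto simp: sphere_bounded_def)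
  then have "\<forall>v\<in>unit_sphere d. cmod (f v * g v) \<le> \<bar>B\<bar> * \<bar>C\<bar>"
    by (auto simp: norm_mult intro!: mult_mono intro: order_trans[OF _ abs_ge_self])
  then show ?thesis
    using assms by (auto simp: sphere_bounded_def)
qed

lemma sphere_bounded_sum:
  "(\<And>i. i \<in> I \<Longrightarrow> sphere_bounded (f i)) \<Longrightarrow> sphere_bounded (\<lambda>v. \<Sum>i\<in>I. f i v)"
  by (induction I rule: infinite_finite_induct)
    (auto intro: sphere_bounded_const sphere_bounded_add)

lemma sphere_bounded_prod:
  "(\<And>i. i \<in> I \<Longrightarrow> sphere_bounded (f i)) \<Longrightarrow> sphere_bounded (\<lambda>v. \<Prod>i\<in>I. f i v)"
  by (induction I rule: infinite_finite_induct)
    (auto intro: sphere_bounded_const sphere_bounded_mult)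

lemmas sphere_bounded_basic = sphere_bounded_const sphere_bounded_coordinate sphere_bounded_cnj
  sphere_bounded_add sphere_bounded_diff sphere_bounded_mult sphere_bounded_sum sphere_bounded_prod

lemma sphere_bounded_sesq:
  assumes "\<And>i. i < d \<Longrightarrow> sphere_bounded (\<lambda>v. f v i)" "\<And>i. i < d \<Longrightarrow> sphere_bounded (\<lambda>v. g v i)"
  shows "sphere_bounded (\<lambda>v. sesq d A (f v) (g v))"
  unfolding sesq_def by (intro sphere_bounded_basic assms) auto

lemma sphere_bounded_cinner:
  assumes "\<And>i. i < d \<Longrightarrow> sphere_bounded (\<lambda>v. f v i)" "\<And>i. i < d \<Longrightarrow> sphere_bounded (\<lambda>v. g v i)"
  shows "sphere_bounded (\<lambda>v. cinner d (f v) (g v))"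
  unfolding cinner_def by (intro sphere_bounded_basic assms) auto

lemma sphere_bounded_qform: "sphere_bounded (qform d A)"
  unfolding qform_eq_sesq[abs_def]
  by (intro sphere_bounded_sesq sphere_bounded_basic)

lemmas sphere_bounded_intros =
  sphere_bounded_basic sphere_bounded_sesq sphere_bounded_cinner sphere_bounded_qform

lemma sphere_boundedD_measurable: "sphere_bounded f \<Longrightarrow> f \<in> borel_measurable \<mu>"
  by (simp add: sphere_bounded_def)

section \<open>Differentiating the invariance of the measure\<close>

text \<open>Change of variables under the unitary of \<open>unitary_rank_one_perturbation\<close>.
  The left integrand is the right one at the image of \<open>v\<close>, expanded in \<open>e\<close>
  and \<open>cnj e\<close> so that its first-order part can be read off.\<close>

lemma integral_prod_qform_rank_one_perturbation:
  assumes u: "(\<Sum>i<d. (cmod (u i))\<^sup>2) = 1" and e: "cmod (1 + e) = 1"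
  shows "(\<integral>v. (\<Prod>k\<in>I. qform d (A k) v + e * (cinner d u v * sesq d (A k) v u)
            + cnj e * (cnj (cinner d u v) * sesq d (A k) u v)
            + e * cnj e * (cinner d u v * cnj (cinner d u v) * sesq d (A k) u u)) \<partial>\<mu>)
         = (\<integral>v. (\<Prod>k\<in>I. qform d (A k) v) \<partial>\<mu>)"
proof -
  define U where "U = (\<lambda>i j. (if i = j then 1 else 0) + e * u i * cnj (u j))"
  have *: "qform d (A k) (mat_apply d U v) = qform d (A k) v + e * (cinner d u v * sesq d (A k) v u)
            + cnj e * (cnj (cinner d u v) * sesq d (A k) u v)
            + e * cnj e * (cinner d u v * cnj (cinner d u v) * sesq d (A k) u u)" for v k
  proof -
    have w: "mat_apply d U v i = v i + (e * cinner d u v) * u i" if "i < d" for i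
      using that by (simp add: U_def mat_apply_rank_one_perturbation)
    from sesq_add_scaled[where w = "mat_apply d U v", OF w] show ?thesis
      unfolding qform_eq_sesq by (simp add: mult_ac)
  qed
  have inv: "distr \<mu> (cvec_space d) (mat_apply d U) = \<mu>"
    using haar unitary_rank_one_perturbation[OF u e] unfolding haar_sphere_def U_def by blast
  \<comment> \<open>The value \<open>undefined\<close> outside the first \<open>d\<close>
    coordinates is what makes the image extensional, as the product space requires.\<close>
  have U: "mat_apply d U \<in> measurable \<mu> (cvec_space d)"
    unfolding cvec_space_def mat_apply_def
    by (rule measurable_PiM_single') (auto simp: PiE_def extensional_def)
  have "(\<lambda>v. \<Prod>k\<in>I. qform d (A k) v) \<in> borel_measurable \<mu>"
    by (intro sphere_boundedD_measurable sphere_bounded_intros)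
  then have "(\<lambda>v. \<Prod>k\<in>I. qform d (A k) v) \<in> borel_measurable (cvec_space d)"
    unfolding measurable_cong_sets[OF sets_eq refl] .
  from integral_distr[OF U this] show ?thesis
    unfolding inv * by simp
qed

text \<open>First-order term of the previous identity at \<open>e = 0\<close>. The admissible
  \<open>e\<close> lie on a circle tangent to the imaginary axis, so the parts linear in
  \<open>e\<close> and in \<open>cnj e\<close> enter with opposite signs. Dominated convergence
  moves the limit inside the integral.\<close>

lemma integral_derivative_unit:
  assumes u: "(\<Sum>i<d. (cmod (u i))\<^sup>2) = 1" and I: "finite I"
  shows "(\<integral>v. (\<Sum>k\<in>I. (cinner d u v * sesq d (A k) v u - cnj (cinner d u v) * sesq d (A k) u v)
            * (\<Prod>j\<in>I - {k}. qform d (A j) v)) \<partial>\<mu>) = 0" (is "integral\<^sup>L \<mu> ?g = 0")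
proof -
  \<comment> \<open>\<open>1 + e n\<close> is the Cayley transform \<open>(r + \<i>) / (r - \<i>)\<close>: it has modulus one and \<open>r n * e n \<longlonglongrightarrow> 2 * \<i>\<close>.\<close>
  define r where "r n = complex_of_real (real (Suc n))" for n
  define e where "e n = 2 * \<i> / (r n - \<i>)" for n
  have r_cmod: "cmod (r n) \<le> cmod (r n - \<i>)" for n
    unfolding r_def cmod_def by (intro real_sqrt_le_mono) simp
  have r_nz: "r n - \<i> \<noteq> 0" for n
    by (simp add: r_def complex_eq_iff)
  have e1: "cmod (1 + e n) = 1" for n
  proof -
    have "1 + e n = (r n + \<i>) / (r n - \<i>)"
      using r_nz[of n] by (simp add: e_def field_simps)
    moreover have "cmod (r n + \<i>) = cmod (r n - \<i>)"
      by (simp add: r_def cmod_def)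
    ultimately show ?thesis using r_nz[of n] by (simp add: norm_divide)
  qed
  have re_bound: "cmod (r n * e n) \<le> 2" for n
    using r_cmod[of n] r_nz[of n] by (simp add: e_def norm_mult norm_divide divide_le_eq)
  have r_ge1: "1 \<le> cmod (r n)" for n
    unfolding r_def norm_of_real by simp
  have e_bound: "cmod (e n) \<le> 2" for n
    using re_bound[of n] r_ge1[of n] mult_right_mono[OF r_ge1[of n], of "cmod (e n)"]
    by (simp add: norm_mult)
  have e_lim: "e \<longlonglongrightarrow> 0"
  proof (rule Lim_null_comparison)
    show "\<forall>\<^sub>F n in sequentially. norm (e n) \<le> 2 / real (Suc n)"
    proof (intro always_eventually allI)
      fix n show "norm (e n) \<le> 2 / real (Suc n)"
        using re_bound[of n] unfolding norm_mult r_def norm_of_real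
        by (simp add: pos_le_divide_eq mult.commute)
    qed
    show "(\<lambda>n. 2 / real (Suc n)) \<longlonglongrightarrow> 0"
      by (rule LIMSEQ_Suc[OF lim_const_over_n])
  qed
  have re_lim: "(\<lambda>n. r n * e n) \<longlonglongrightarrow> 2 * \<i>"
  proof -
    have "r n * e n = 2 * \<i> + \<i> * e n" for n
      using r_nz[of n] by (simp add: e_def field_simps)
    then show ?thesis
      using tendsto_add[OF tendsto_const tendsto_mult[OF tendsto_const e_lim], of "2 * \<i>" "\<i>"]
      by simp
  qed
  have r_cnj: "cnj (r n) = r n" for n by (simp add: r_def)
  define a where "a k v = qform d (A k) v" for k v
  define b where "b k v = cinner d u v * sesq d (A k) v u" for k v
  define c where "c k v = cnj (cinner d u v) * sesq d (A k) u v" for k v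
  define g where "g k v = cinner d u v * cnj (cinner d u v) * sesq d (A k) u u" for k v
  have sb: "sphere_bounded (a k)" "sphere_bounded (b k)" "sphere_bounded (c k)" "sphere_bounded (g k)" for k
    unfolding a_def b_def c_def g_def by (intro sphere_bounded_intros; assumption)+
  define x where "x n k v = a k v + e n * b k v + cnj (e n) * c k v + e n * cnj (e n) * g k v" for n k v
  define s where "s n v = r n * ((\<Prod>k\<in>I. x n k v) - (\<Prod>k\<in>I. a k v))" for n v
  have sbx: "sphere_bounded (x n k)" for n k
    unfolding x_def[abs_def] by (intro sphere_bounded_intros sb)
  have s_int: "integral\<^sup>L \<mu> (s n) = 0" for n
  proof -
    have "(\<integral>v. (\<Prod>k\<in>I. x n k v) \<partial>\<mu>) = (\<integral>v. (\<Prod>k\<in>I. a k v) \<partial>\<mu>)"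
      unfolding x_def a_def b_def c_def g_def
      by (rule integral_prod_qform_rank_one_perturbation[OF u e1])
    moreover have "integrable \<mu> (\<lambda>v. \<Prod>k\<in>I. x n k v)" "integrable \<mu> (\<lambda>v. \<Prod>k\<in>I. a k v)"
      by (intro sphere_bounded_integrable sphere_bounded_intros sb sbx)+
    ultimately show ?thesis unfolding s_def by simp
  qed
  define l where "l v = (\<Sum>k\<in>I. (2 * \<i> * (b k v - c k v)) * (\<Prod>j\<in>I - {k}. a j v))" for v
  have s_lim: "(\<lambda>n. s n v) \<longlonglongrightarrow> l v" for v
    unfolding s_def l_def
  proof (rule prod_diff_quotient_tendsto[OF I])
    fix k
    have "(\<lambda>n. a k v + e n * b k v + cnj (e n) * c k v + e n * cnj (e n) * g k v)
       \<longlonglongrightarrow> a k v + 0 * b k v + cnj 0 * c k v + 0 * cnj 0 * g k v"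
      by (intro tendsto_intros e_lim)
    then show "(\<lambda>n. x n k v) \<longlonglongrightarrow> a k v" by (simp add: x_def)
    \<comment> \<open>Since \<open>r n\<close> is real, \<open>r n * cnj (e n)\<close> is the
      conjugate of \<open>r n * e n\<close> and tends to \<open>- 2 * \<i>\<close>. The quadratic
      term retains a factor that tends to zero.\<close>
    have "(\<lambda>n. r n * e n * b k v + cnj (r n * e n) * c k v + r n * e n * cnj (e n) * g k v)
       \<longlonglongrightarrow> 2 * \<i> * b k v + cnj (2 * \<i>) * c k v + 2 * \<i> * cnj 0 * g k v"
      by (intro tendsto_intros e_lim re_lim)
    moreover have "r n * (x n k v - a k v)
       = r n * e n * b k v + cnj (r n * e n) * c k v + r n * e n * cnj (e n) * g k v" for n
      by (simp add: x_def r_cnj algebra_simps)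
    ultimately show "(\<lambda>n. r n * (x n k v - a k v)) \<longlonglongrightarrow> 2 * \<i> * (b k v - c k v)"
      by (simp add: algebra_simps)
  qed
  have "\<exists>K. \<forall>k\<in>I. \<forall>v\<in>unit_sphere d. cmod (a k v) \<le> K \<and> cmod (b k v) \<le> K
          \<and> cmod (c k v) \<le> K \<and> cmod (g k v) \<le> K"
  proof -
    have "\<exists>K. \<forall>v\<in>unit_sphere d. cmod (a k v) \<le> K \<and> cmod (b k v) \<le> K
          \<and> cmod (c k v) \<le> K \<and> cmod (g k v) \<le> K" for k
    proof -
      from sb[of k] obtain K1 K2 K3 K4 where
        "\<forall>v\<in>unit_sphere d. cmod (a k v) \<le> K1" "\<forall>v\<in>unit_sphere d. cmod (b k v) \<le> K2"
        "\<forall>v\<in>unit_sphere d. cmod (c k v) \<le> K3" "\<forall>v\<in>unit_sphere d. cmod (g k v) \<le> K4"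
        unfolding sphere_bounded_def by blast
      then show ?thesis
        by (intro exI[of _ "max (max K1 K2) (max K3 K4)"]) (simp add: le_max_iff_disj)
    qed
    then obtain K where K: "\<And>k. \<forall>v\<in>unit_sphere d. cmod (a k v) \<le> K k \<and> cmod (b k v) \<le> K k
          \<and> cmod (c k v) \<le> K k \<and> cmod (g k v) \<le> K k" by metis
    have "K k \<le> (\<Sum>k\<in>I. \<bar>K k\<bar>)" if "k \<in> I" for k
      using member_le_sum[OF that, of "\<lambda>k. \<bar>K k\<bar>"] I by simp
    then show ?thesis using K by (meson order_trans)
  qed
  then obtain K0 where K0: "\<And>k v. k \<in> I \<Longrightarrow> v \<in> unit_sphere d \<Longrightarrow> cmod (a k v) \<le> K0 \<and> cmod (b k v) \<le> K0
          \<and> cmod (c k v) \<le> K0 \<and> cmod (g k v) \<le> K0" by blast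
  define K where "K = max 1 K0"
  have K1: "1 \<le> K" by (simp add: K_def)
  have K: "cmod (a k v) \<le> K" "cmod (b k v) \<le> K" "cmod (c k v) \<le> K" "cmod (g k v) \<le> K"
    if "k \<in> I" "v \<in> unit_sphere d" for k v
    using K0[OF that] by (auto simp: K_def)
  \<comment> \<open>The constant is \<open>K + K + 2 * K\<close>: in the quadratic term one of the
    two factors of modulus \<open>cmod (e n)\<close> is bounded by 2.\<close>
  have diff: "cmod (x n k v - a k v) \<le> cmod (e n) * (4 * K)" if "k \<in> I" "v \<in> unit_sphere d" for n k v
  proof -
    have "cmod (x n k v - a k v) = cmod (e n * b k v + cnj (e n) * c k v + e n * cnj (e n) * g k v)"
      by (simp add: x_def add.assoc)
    also have "\<dots> \<le> cmod (e n * b k v) + cmod (cnj (e n) * c k v) + cmod (e n * cnj (e n) * g k v)"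
      by (intro order_trans[OF norm_triangle_ineq] add_mono order_refl)
    also have "\<dots> = cmod (e n) * (cmod (b k v) + cmod (c k v) + cmod (e n) * cmod (g k v))"
      by (simp add: norm_mult algebra_simps)
    also have "\<dots> \<le> cmod (e n) * (K + K + 2 * K)"
      by (intro mult_left_mono add_mono mult_mono K that e_bound) auto
    finally show ?thesis by simp
  qed
  \<comment> \<open>Perturbed factors are at most \<open>2 * (4 * K) + K = 9 * K\<close>. The factor
    \<open>r n\<close> is absorbed through \<open>cmod (r n * e n) \<le> 2\<close>, which doubles
    \<open>4 * K\<close> to \<open>8 * K\<close> and makes the bound independent of
    \<open>n\<close>.\<close>
  have s_bound: "cmod (s n v) \<le> (9 * K) ^ card I * (real (card I) * (8 * K))" if v: "v \<in> unit_sphere d" for n v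
  proof -
    have "cmod ((\<Prod>k\<in>I. x n k v) - (\<Prod>k\<in>I. a k v)) \<le> (9 * K) ^ card I * (\<Sum>k\<in>I. cmod (x n k v - a k v))"
    proof (rule norm_prod_diff_le)
      fix k assume k: "k \<in> I"
      show "cmod (a k v) \<le> 9 * K" using K(1)[OF k v] K1 by simp
      have "cmod (x n k v) \<le> cmod (x n k v - a k v) + cmod (a k v)"
        by (metis diff_add_cancel norm_triangle_ineq)
      also have "\<dots> \<le> cmod (e n) * (4 * K) + K"
        by (intro add_mono diff K k v)
      also have "\<dots> \<le> 2 * (4 * K) + K"
        using K1 by (intro add_mono mult_right_mono e_bound) auto
      finally show "cmod (x n k v) \<le> 9 * K" by simp
    qed (use K1 in simp)
    also have "\<dots> \<le> (9 * K) ^ card I * (\<Sum>k\<in>I. cmod (e n) * (4 * K))"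
      using K1 by (intro mult_left_mono sum_mono diff v) auto
    finally have "cmod (r n) * cmod ((\<Prod>k\<in>I. x n k v) - (\<Prod>k\<in>I. a k v))
       \<le> cmod (r n) * ((9 * K) ^ card I * (\<Sum>k\<in>I. cmod (e n) * (4 * K)))"
      by (rule mult_left_mono) simp
    also have "\<dots> = cmod (r n * e n) * ((9 * K) ^ card I * (real (card I) * (4 * K)))"
      by (simp add: norm_mult)
    also have "\<dots> \<le> 2 * ((9 * K) ^ card I * (real (card I) * (4 * K)))"
      using K1 by (intro mult_right_mono re_bound) auto
    finally show ?thesis by (simp add: s_def norm_mult mult_ac)
  qed
  have "(\<lambda>n. integral\<^sup>L \<mu> (s n)) \<longlonglongrightarrow> integral\<^sup>L \<mu> l"
  proof (rule integral_dominated_convergence)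
    show "l \<in> borel_measurable \<mu>" unfolding l_def[abs_def]
      by (intro sphere_boundedD_measurable sphere_bounded_intros sb)
    show "s n \<in> borel_measurable \<mu>" for n unfolding s_def[abs_def]
      by (intro sphere_boundedD_measurable sphere_bounded_intros sb sbx)
    show "AE v in \<mu>. (\<lambda>n. s n v) \<longlonglongrightarrow> l v" using s_lim by simp
    show "AE v in \<mu>. cmod (s n v) \<le> (9 * K) ^ card I * (real (card I) * (8 * K))" for n
      using AE_unit_sphere s_bound by auto
  qed simp
  then have "integral\<^sup>L \<mu> l = 0"
    unfolding s_int by (simp add: LIMSEQ_const_iff)
  moreover have "l = (\<lambda>v. 2 * \<i> * ?g v)"
    unfolding fun_eq_iff l_def a_def b_def c_def sum_distrib_left
    by (intro allI sum.cong refl) (rule mult.assoc)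
  ultimately show ?thesis by simp
qed


section \<open>From rank-one directions to matrix units\<close>

text \<open>The row vector obtained from \<open>A\<close> and the adjoint of \<open>v\<close>.
  Paired with the column vector \<open>rmul B v\<close> it splits the form of a product at the inner
  index.\<close>

definition lmul :: "(nat \<Rightarrow> nat \<Rightarrow> complex) \<Rightarrow> (nat \<Rightarrow> complex) \<Rightarrow> nat \<Rightarrow> complex" where
  "lmul A v i = (\<Sum>a<d. cnj (v a) * A a i)"

definition rmul :: "(nat \<Rightarrow> nat \<Rightarrow> complex) \<Rightarrow> (nat \<Rightarrow> complex) \<Rightarrow> nat \<Rightarrow> complex" where
  "rmul A v j = (\<Sum>b<d. A j b * v b)"

lemma sphere_bounded_lmul: "sphere_bounded (\<lambda>v. lmul A v i)"
  unfolding lmul_def by (intro sphere_bounded_intros) auto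

lemma sphere_bounded_rmul: "sphere_bounded (\<lambda>v. rmul A v i)"
  unfolding rmul_def by (intro sphere_bounded_intros) auto

text \<open>The identity for unit vectors \<open>u\<close> says that a quadratic form in
  \<open>u\<close> with coefficients \<open>\<phi> i j\<close> vanishes on the unit sphere.
  Homogeneity extends this to all \<open>u\<close>, and polarisation kills every coefficient. The
  integrand is the Leibniz derivative in which each \<open>A k\<close> is replaced by its commutator
  with the matrix unit at position \<open>(i, j)\<close>.\<close>

lemma integral_derivative_elementary:
  assumes "finite I" "i < d" "j < d"
  shows "(\<integral>v. (\<Sum>k\<in>I. (lmul (A k) v i * v j - cnj (v i) * rmul (A k) v j)
            * (\<Prod>l\<in>I - {k}. qform d (A l) v)) \<partial>\<mu>) = 0"
proof -
  define \<psi> where "\<psi> i j v = (\<Sum>k\<in>I. (lmul (A k) v i * v j - cnj (v i) * rmul (A k) v j)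
            * (\<Prod>l\<in>I - {k}. qform d (A l) v))" for i j v
  define \<phi> where "\<phi> i j = integral\<^sup>L \<mu> (\<psi> i j)" for i j
  have sb\<psi>: "sphere_bounded (\<psi> i j)" if "i < d" "j < d" for i j
    unfolding \<psi>_def[abs_def] by (intro sphere_bounded_intros sphere_bounded_lmul sphere_bounded_rmul that)
  have unit: "(\<Sum>i<d. \<Sum>j<d. u i * cnj (u j) * \<phi> i j) = 0" if u: "(\<Sum>i<d. (cmod (u i))\<^sup>2) = 1" for u
  proof -
    have 1: "cinner d u v * sesq d (A k) v u = (\<Sum>i<d. \<Sum>j<d. u i * cnj (u j) * (lmul (A k) v i * v j))" for k v
    proof -
      have "sesq d (A k) v u = (\<Sum>i<d. u i * lmul (A k) v i)"
        unfolding sesq_def lmul_def by (subst sum.swap) (simp add: sum_distrib_left mult_ac)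
      then show ?thesis
        unfolding cinner_def by (simp only: sum_product) (subst sum.swap, simp add: mult_ac)
    qed
    have 2: "cnj (cinner d u v) * sesq d (A k) u v = (\<Sum>i<d. \<Sum>j<d. u i * cnj (u j) * (cnj (v i) * rmul (A k) v j))" for k v
    proof -
      have "sesq d (A k) u v = (\<Sum>j<d. cnj (u j) * rmul (A k) v j)"
        unfolding sesq_def rmul_def by (simp add: sum_distrib_left mult_ac)
      then show ?thesis
        by (simp add: cinner_def sum_product mult_ac)
    qed
    have "(\<Sum>k\<in>I. (cinner d u v * sesq d (A k) v u - cnj (cinner d u v) * sesq d (A k) u v)
            * (\<Prod>j\<in>I - {k}. qform d (A j) v)) = (\<Sum>i<d. \<Sum>j<d. u i * cnj (u j) * \<psi> i j v)" for v
    proof -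
      have "(cinner d u v * sesq d (A k) v u - cnj (cinner d u v) * sesq d (A k) u v)
            * (\<Prod>j\<in>I - {k}. qform d (A j) v)
         = (\<Sum>i<d. \<Sum>j<d. u i * cnj (u j) * ((lmul (A k) v i * v j - cnj (v i) * rmul (A k) v j)
            * (\<Prod>l\<in>I - {k}. qform d (A l) v)))" for k
        unfolding 1 2 sum_subtractf[symmetric] sum_distrib_right
        by (intro sum.cong refl) (simp add: algebra_simps)
      then show ?thesis
        unfolding \<psi>_def sum_distrib_left
        by (simp add: sum.swap[of _ I])
    qed
    with integral_derivative_unit[OF u assms(1), of A]
    have "(\<integral>v. (\<Sum>i<d. \<Sum>j<d. u i * cnj (u j) * \<psi> i j v) \<partial>\<mu>) = 0" by simp
    also have "(\<integral>v. (\<Sum>i<d. \<Sum>j<d. u i * cnj (u j) * \<psi> i j v) \<partial>\<mu>)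
        = (\<Sum>i<d. \<integral>v. (\<Sum>j<d. u i * cnj (u j) * \<psi> i j v) \<partial>\<mu>)"
      by (intro Bochner_Integration.integral_sum sphere_bounded_integrable sphere_bounded_intros sb\<psi>) auto
    also have "\<dots> = (\<Sum>i<d. \<Sum>j<d. \<integral>v. u i * cnj (u j) * \<psi> i j v \<partial>\<mu>)"
      by (intro sum.cong refl Bochner_Integration.integral_sum sphere_bounded_integrable sphere_bounded_intros sb\<psi>) auto
    also have "\<dots> = (\<Sum>i<d. \<Sum>j<d. u i * cnj (u j) * \<phi> i j)"
      by (simp add: \<phi>_def)
    finally show ?thesis .
  qed
  have "(\<Sum>i<d. \<Sum>j<d. u i * cnj (u j) * \<phi> i j) = 0" for u
  proof (cases "(\<Sum>i<d. (cmod (u i))\<^sup>2) = 0")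
    case True
    then have "\<forall>i<d. u i = 0" by (subst (asm) sum_nonneg_eq_0_iff) auto
    then show ?thesis by simp
  next
    case False
    define t where "t = sqrt (\<Sum>i<d. (cmod (u i))\<^sup>2)"
    have t2: "t\<^sup>2 = (\<Sum>i<d. (cmod (u i))\<^sup>2)" by (simp add: t_def sum_nonneg)
    with False have t: "t \<noteq> 0" by auto
    have "(\<Sum>i<d. (cmod (u i / t))\<^sup>2) = (\<Sum>i<d. (cmod (u i))\<^sup>2) / t\<^sup>2"
      by (simp add: norm_divide power_divide sum_divide_distrib)
    also have "\<dots> = 1" using t by (simp add: t2[symmetric])
    finally have "0 = (\<Sum>i<d. \<Sum>j<d. (u i / t) * cnj (u j / t) * \<phi> i j)"
      by (simp only: unit[of "\<lambda>i. u i / t"])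
    also have "\<dots> = (\<Sum>i<d. \<Sum>j<d. u i * cnj (u j) * \<phi> i j) / t\<^sup>2"
      by (simp add: sum_divide_distrib power2_eq_square)
    finally show ?thesis using t by simp
  qed
  from quadratic_form_zero_imp_zero[OF this assms(2,3)] show ?thesis
    by (simp add: \<phi>_def \<psi>_def[abs_def])
qed

lemma qform_rmul: "qform d A v = (\<Sum>i<d. cnj (v i) * rmul A v i)"
  by (simp add: qform_def rmul_def sum_distrib_left mult_ac)

lemma qform_mat_mult: "qform d (mat_mult d A B) v = (\<Sum>i<d. lmul A v i * rmul B v i)"
proof -
  have "qform d (mat_mult d A B) v = (\<Sum>a<d. \<Sum>b<d. \<Sum>i<d. cnj (v a) * A a i * (B i b * v b))"
    by (simp add: qform_def mat_mult_def sum_distrib_left sum_distrib_right mult_ac)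
  also have "\<dots> = (\<Sum>a<d. \<Sum>i<d. \<Sum>b<d. cnj (v a) * A a i * (B i b * v b))"
    by (intro sum.cong refl sum.swap)
  also have "\<dots> = (\<Sum>i<d. \<Sum>a<d. \<Sum>b<d. cnj (v a) * A a i * (B i b * v b))"
    by (rule sum.swap)
  finally show ?thesis by (simp add: lmul_def rmul_def sum_product)
qed

section \<open>The recursion for mixed moments\<close>

definition moment :: "nat \<Rightarrow> (nat \<Rightarrow> nat \<Rightarrow> nat \<Rightarrow> complex) \<Rightarrow> complex" where
  "moment n A = (\<integral>v. (\<Prod>l<n. qform d (A l) v) \<partial>\<mu>)"

text \<open>The coefficient \<open>d + n\<close> collects copies of the full product: after
  contraction the last factor gives its trace minus \<open>d\<close> copies, and each of the other
  \<open>n\<close> factors gives its product with \<open>A n\<close> minus one copy.\<close>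

lemma moment_Suc:
  "of_nat (d + n) * moment (Suc n) A
    = mat_trace d (A n) * moment n A + (\<Sum>k<n. moment n (A(k := mat_mult d (A k) (A n))))"
proof -
  define B where "B = A n"
  \<comment> \<open>\<open>N i j\<close> is \<open>E\<^sub>j\<^sub>i B\<close>; summing the derivative along \<open>E\<^sub>i\<^sub>j\<close> over all \<open>i, j\<close> contracts the two matrix units.\<close>
  define N where "N i j = (\<lambda>a b. if a = j then B i b else 0)" for i j :: nat
  define A' where "A' i j = A(n := N i j)" for i j
  define P where "P v = (\<Prod>l<n. qform d (A l) v)" for v
  define Pk where "Pk k v = (\<Prod>l\<in>{..<n} - {k}. qform d (A l) v)" for k v
  define \<psi> where "\<psi> i j v = (\<Sum>k<Suc n. (lmul (A' i j k) v i * v j - cnj (v i) * rmul (A' i j k) v j)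
            * (\<Prod>l\<in>{..<Suc n} - {k}. qform d (A' i j l) v))" for i j v
  have \<psi>0: "integral\<^sup>L \<mu> (\<psi> i j) = 0" if "i < d" "j < d" for i j
    unfolding \<psi>_def by (rule integral_derivative_elementary) (use that in auto)
  have sb\<psi>: "sphere_bounded (\<psi> i j)" if "i < d" "j < d" for i j
    unfolding \<psi>_def[abs_def] by (intro sphere_bounded_intros sphere_bounded_lmul sphere_bounded_rmul that)
  have PPk: "qform d (A k) v * Pk k v = P v" if "k < n" for k v
    unfolding P_def Pk_def using that by (subst prod.remove[of "{..<n}" k]) auto
  have upd: "(\<Prod>l<n. qform d ((A(k := mat_mult d (A k) B)) l) v) = qform d (mat_mult d (A k) B) v * Pk k v"
    if "k < n" for k v
    unfolding Pk_def using that by (subst prod.remove[of "{..<n}" k]) (auto intro!: prod.cong)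
  have \<psi>_eq: "\<psi> i j v = (cnj (v j) * v j * B i i - cnj (v i) * rmul B v i) * P v
      + (\<Sum>k<n. ((lmul (A k) v i * rmul B v i) * (cnj (v j) * v j)
             - (cnj (v i) * rmul B v i) * (cnj (v j) * rmul (A k) v j)) * Pk k v)"
    if "i < d" "j < d" for i j v
  proof -
    have lN: "lmul (N i j) v i = cnj (v j) * B i i"
    proof -
      have "lmul (N i j) v i = (\<Sum>a<d. if a = j then cnj (v j) * B i i else 0)"
        unfolding lmul_def N_def by (intro sum.cong refl) auto
      then show ?thesis using that by simp
    qed
    have rN: "rmul (N i j) v a = (if a = j then rmul B v i else 0)" for a
      by (simp add: rmul_def N_def)
    have qN: "qform d (N i j) v = cnj (v j) * rmul B v i"
    proof -
      have "qform d (N i j) v = (\<Sum>a<d. if a = j then cnj (v j) * rmul B v i else 0)"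
        unfolding qform_rmul rN by (intro sum.cong refl) auto
      then show ?thesis using that by simp
    qed
    \<comment> \<open>When an earlier factor is differentiated, the last one survives and
      contributes the form of \<open>N i j\<close>. When the last one is differentiated, exactly
      \<open>P v\<close> remains.\<close>
    have k: "(\<Prod>l\<in>{..<Suc n} - {k}. qform d (A' i j l) v) = cnj (v j) * rmul B v i * Pk k v" if "k < n" for k
    proof -
      have "{..<Suc n} - {k} = insert n ({..<n} - {k})" using that by auto
      then show ?thesis by (auto simp: Pk_def A'_def qN intro!: prod.cong)
    qed
    have n: "(\<Prod>l\<in>{..<Suc n} - {n}. qform d (A' i j l) v) = P v"
    proof -
      have "{..<Suc n} - {n} = {..<n}" by auto
      then show ?thesis by (auto simp: P_def A'_def intro!: prod.cong)
    qed
    have "\<psi> i j v = (\<Sum>k<n. (lmul (A k) v i * v j - cnj (v i) * rmul (A k) v j)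
            * (cnj (v j) * rmul B v i * Pk k v)) + (cnj (v j) * B i i * v j - cnj (v i) * rmul B v i) * P v"
      unfolding \<psi>_def sum.lessThan_Suc n
      by (intro arg_cong2[where f="(+)"] sum.cong refl)
        (simp_all only: lessThan_iff k, simp_all add: A'_def lN rN)
    also have "(\<Sum>k<n. (lmul (A k) v i * v j - cnj (v i) * rmul (A k) v j)
            * (cnj (v j) * rmul B v i * Pk k v)) = (\<Sum>k<n. ((lmul (A k) v i * rmul B v i) * (cnj (v j) * v j)
             - (cnj (v i) * rmul B v i) * (cnj (v j) * rmul (A k) v j)) * Pk k v)"
      by (intro sum.cong refl) (simp add: algebra_simps)
    finally show ?thesis by (simp add: mult_ac)
  qed
  have sum_\<psi>: "(\<Sum>i<d. \<Sum>j<d. \<psi> i j v) = mat_trace d B * P v - of_nat (d + n) * (P v * qform d B v)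
     + (\<Sum>k<n. qform d (mat_mult d (A k) B) v * Pk k v)" if v: "v \<in> unit_sphere d" for v
  proof -
    have v1: "(\<Sum>j<d. cnj (v j) * v j) = 1"
      using sum_mult_cnj_eq_1[of v d] v by (simp add: unit_sphere_def mult.commute)
    \<comment> \<open>The sphere equation collapses the sum over \<open>j\<close> in the first term.
      The second term does not depend on \<open>j\<close>, which produces the factor
      \<open>of_nat d\<close>.\<close>
    have a: "(\<Sum>i<d. \<Sum>j<d. (cnj (v j) * v j * B i i - cnj (v i) * rmul B v i) * P v)
       = (mat_trace d B - of_nat d * qform d B v) * P v"
      by (simp add: sum_distrib_right[symmetric] sum_subtractf v1 mat_trace_def qform_rmul sum_distrib_left)
    \<comment> \<open>Here the first term contracts to the form of \<open>A k\<close> times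
      \<open>B\<close>, while the second separates into two forms, one of which restores the factor
      missing from \<open>Pk k v\<close>.\<close>
    have b: "(\<Sum>i<d. \<Sum>j<d. ((lmul (A k) v i * rmul B v i) * (cnj (v j) * v j)
             - (cnj (v i) * rmul B v i) * (cnj (v j) * rmul (A k) v j)) * Pk k v)
       = qform d (mat_mult d (A k) B) v * Pk k v - qform d B v * P v" if "k < n" for k
    proof -
      have "(\<Sum>i<d. \<Sum>j<d. ((lmul (A k) v i * rmul B v i) * (cnj (v j) * v j)
             - (cnj (v i) * rmul B v i) * (cnj (v j) * rmul (A k) v j)) * Pk k v)
        = (qform d (mat_mult d (A k) B) v - qform d B v * qform d (A k) v) * Pk k v"
        unfolding sum_distrib_right[symmetric] sum_subtractf sum_distrib_left[symmetric] v1
          qform_mat_mult by (simp add: qform_rmul)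
      then show ?thesis by (simp add: algebra_simps PPk[OF that, symmetric])
    qed
    have "(\<Sum>i<d. \<Sum>j<d. \<psi> i j v)
        = (\<Sum>i<d. \<Sum>j<d. (cnj (v j) * v j * B i i - cnj (v i) * rmul B v i) * P v)
        + (\<Sum>k<n. \<Sum>i<d. \<Sum>j<d. ((lmul (A k) v i * rmul B v i) * (cnj (v j) * v j)
             - (cnj (v i) * rmul B v i) * (cnj (v j) * rmul (A k) v j)) * Pk k v)"
      by (simp add: \<psi>_eq sum.distrib sum.swap[of _ "{..<n}"])
    also have "\<dots> = (mat_trace d B - of_nat d * qform d B v) * P v
        + (\<Sum>k<n. qform d (mat_mult d (A k) B) v * Pk k v - qform d B v * P v)"
      unfolding a using b by simp
    finally show ?thesis by (simp add: sum_subtractf algebra_simps)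
  qed
  have "0 = (\<Sum>i<d. \<Sum>j<d. integral\<^sup>L \<mu> (\<psi> i j))"
    by (simp add: \<psi>0)
  also have "\<dots> = (\<Sum>i<d. \<integral>v. (\<Sum>j<d. \<psi> i j v) \<partial>\<mu>)"
    by (intro sum.cong refl Bochner_Integration.integral_sum[symmetric] sphere_bounded_integrable sb\<psi>) auto
  also have "\<dots> = (\<integral>v. (\<Sum>i<d. \<Sum>j<d. \<psi> i j v) \<partial>\<mu>)"
    by (intro Bochner_Integration.integral_sum[symmetric] sphere_bounded_integrable sphere_bounded_intros sb\<psi>) auto
  also have "\<dots> = (\<integral>v. mat_trace d B * P v - of_nat (d + n) * (P v * qform d B v)
     + (\<Sum>k<n. qform d (mat_mult d (A k) B) v * Pk k v) \<partial>\<mu>)"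
    by (intro integral_cong_AE sphere_boundedD_measurable sphere_bounded_intros sb\<psi>)
      (use AE_unit_sphere sum_\<psi> in \<open>auto simp: P_def Pk_def intro!: sphere_bounded_intros\<close>)
  also have "\<dots> = mat_trace d B * integral\<^sup>L \<mu> P - of_nat (d + n) * (\<integral>v. P v * qform d B v \<partial>\<mu>)
     + (\<Sum>k<n. \<integral>v. qform d (mat_mult d (A k) B) v * Pk k v \<partial>\<mu>)"
  proof -
    have sbP: "sphere_bounded P" "sphere_bounded (Pk k)" for k
      unfolding P_def[abs_def] Pk_def[abs_def] by (intro sphere_bounded_intros)+
    have "integrable \<mu> P" "integrable \<mu> (\<lambda>v. P v * qform d B v)"
      "integrable \<mu> (\<lambda>v. qform d (mat_mult d (A k) B) v * Pk k v)" for k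
      by (intro sphere_bounded_integrable sphere_bounded_intros sbP)+
    then show ?thesis by simp
  qed
  finally have "of_nat (d + n) * (\<integral>v. P v * qform d B v \<partial>\<mu>) = mat_trace d B * integral\<^sup>L \<mu> P
     + (\<Sum>k<n. \<integral>v. qform d (mat_mult d (A k) B) v * Pk k v \<partial>\<mu>)"
    by (simp add: algebra_simps)
  moreover have "(\<Sum>k<n. \<integral>v. qform d (mat_mult d (A k) B) v * Pk k v \<partial>\<mu>) =
    (\<Sum>k<n. moment n (A(k := mat_mult d (A k) B)))"
    unfolding moment_def by (intro sum.cong refl) (simp only: lessThan_iff upd)
  ultimately show ?thesis
    by (simp add: moment_def P_def[abs_def] B_def)
qed

end

section \<open>Inequalities for the Hilbert-Schmidt norm\<close>

lemma hs_norm_eq_L2_set: "hs_norm d A = L2_set (\<lambda>(i, j). cmod (A i j)) ({..<d} \<times> {..<d})"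
  by (simp add: hs_norm_def L2_set_def sum.cartesian_product case_prod_beta)

lemma hs_norm_nonneg: "0 \<le> hs_norm d A"
  by (simp add: hs_norm_eq_L2_set L2_set_nonneg)

lemma hs_norm_power2: "(hs_norm d A)\<^sup>2 = (\<Sum>i<d. \<Sum>j<d. (cmod (A i j))\<^sup>2)"
  by (simp add: hs_norm_def sum_nonneg)

text \<open>Cauchy-Schwarz over all index pairs; transposing \<open>B\<close> leaves its norm
  unchanged.\<close>

lemma cmod_mat_trace_mult_le:
  "cmod (mat_trace d (mat_mult d A B)) \<le> hs_norm d A * hs_norm d B"
proof -
  have "cmod (mat_trace d (mat_mult d A B)) \<le> (\<Sum>i<d. \<Sum>k<d. cmod (A i k) * cmod (B k i))"
    unfolding mat_trace_def mat_mult_def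
    by (intro order_trans[OF norm_sum] sum_mono) (simp add: norm_mult)
  also have "\<dots> = (\<Sum>(i, k)\<in>{..<d} \<times> {..<d}. \<bar>cmod (A i k)\<bar> * \<bar>cmod (B k i)\<bar>)"
    by (simp add: sum.cartesian_product)
  also have "\<dots> \<le> L2_set (\<lambda>(i, k). cmod (A i k)) ({..<d} \<times> {..<d})
      * L2_set (\<lambda>(i, k). cmod (B k i)) ({..<d} \<times> {..<d})"
    using L2_set_mult_ineq[of "\<lambda>(i, k). cmod (A i k)" "\<lambda>(i, k). cmod (B k i)" "{..<d} \<times> {..<d}"]
    by (simp add: case_prod_beta)
  also have "L2_set (\<lambda>(i, k). cmod (B k i)) ({..<d} \<times> {..<d}) = hs_norm d B"
  proof -
    have "(\<Sum>i<d. \<Sum>k<d. (cmod (B k i))\<^sup>2) = (\<Sum>k<d. \<Sum>i<d. (cmod (B k i))\<^sup>2)"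
      by (rule sum.swap)
    then show ?thesis
      by (simp add: hs_norm_def L2_set_def sum.cartesian_product case_prod_beta)
  qed
  finally show ?thesis by (simp add: hs_norm_eq_L2_set)
qed

text \<open>Cauchy-Schwarz for row \<open>i\<close> of \<open>A\<close> against column
  \<open>j\<close> of \<open>B\<close>; the sum of the squared bounds over \<open>i\<close> and
  \<open>j\<close> factorises.\<close>

lemma hs_norm_mat_mult_le: "hs_norm d (mat_mult d A B) \<le> hs_norm d A * hs_norm d B"
proof (rule power2_le_imp_le)
  have "(cmod (mat_mult d A B i j))\<^sup>2 \<le> (\<Sum>k<d. (cmod (A i k))\<^sup>2) * (\<Sum>k<d. (cmod (B k j))\<^sup>2)" for i j
  proof -
    have "cmod (mat_mult d A B i j) \<le> (\<Sum>k<d. \<bar>cmod (A i k)\<bar> * \<bar>cmod (B k j)\<bar>)"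
      unfolding mat_mult_def by (intro order_trans[OF norm_sum] sum_mono) (simp add: norm_mult)
    also have "\<dots> \<le> L2_set (\<lambda>k. cmod (A i k)) {..<d} * L2_set (\<lambda>k. cmod (B k j)) {..<d}"
      by (rule L2_set_mult_ineq)
    finally have "(cmod (mat_mult d A B i j))\<^sup>2
        \<le> (L2_set (\<lambda>k. cmod (A i k)) {..<d} * L2_set (\<lambda>k. cmod (B k j)) {..<d})\<^sup>2"
      by (intro power_mono) auto
    then show ?thesis
      by (simp add: power_mult_distrib L2_set_def sum_nonneg)
  qed
  then have "(hs_norm d (mat_mult d A B))\<^sup>2
      \<le> (\<Sum>i<d. \<Sum>j<d. (\<Sum>k<d. (cmod (A i k))\<^sup>2) * (\<Sum>k<d. (cmod (B k j))\<^sup>2))"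
    unfolding hs_norm_power2 by (intro sum_mono)
  also have "\<dots> = (\<Sum>i<d. \<Sum>k<d. (cmod (A i k))\<^sup>2) * (\<Sum>j<d. \<Sum>k<d. (cmod (B k j))\<^sup>2)"
    by (rule sum_product[symmetric])
  also have "(\<Sum>j<d. \<Sum>k<d. (cmod (B k j))\<^sup>2) = (\<Sum>k<d. \<Sum>j<d. (cmod (B k j))\<^sup>2)"
    by (rule sum.swap)
  finally show "(hs_norm d (mat_mult d A B))\<^sup>2 \<le> (hs_norm d A * hs_norm d B)\<^sup>2"
    by (simp add: power_mult_distrib hs_norm_power2)
qed (simp add: hs_norm_nonneg)

text \<open>The trace of a product is controlled by Hilbert-Schmidt norms, not by traces. Bounding
  both quantities by one weight gives a property that passes to products with multiplied weights, as
  the recursion requires.\<close>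

definition trace_hs_le :: "nat \<Rightarrow> (nat \<Rightarrow> nat \<Rightarrow> complex) \<Rightarrow> real \<Rightarrow> bool" where
  "trace_hs_le d A w \<longleftrightarrow> cmod (mat_trace d A) \<le> w \<and> hs_norm d A \<le> w"

lemma trace_hs_le_nonneg: "trace_hs_le d A w \<Longrightarrow> 0 \<le> w"
  using hs_norm_nonneg[of d A] by (simp add: trace_hs_le_def)

lemma trace_hs_le_mat_mult:
  assumes "trace_hs_le d A w" "trace_hs_le d B z"
  shows "trace_hs_le d (mat_mult d A B) (w * z)"
proof -
  have "hs_norm d A * hs_norm d B \<le> w * z"
    using assms trace_hs_le_nonneg[OF assms(1)]
    by (intro mult_mono) (auto simp: trace_hs_le_def hs_norm_nonneg)
  then show ?thesis
    using cmod_mat_trace_mult_le[of d A B] hs_norm_mat_mult_le[of d A B]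
    by (simp add: trace_hs_le_def)
qed

section \<open>Quantum states have Hilbert-Schmidt norm at most one\<close>

text \<open>Positivity bounds each squared entry by the product of the two corresponding diagonal
  entries. Summed over all pairs, these products give the square of the trace, which is one.\<close>

lemma quantum_state_hs_norm_le_1:
  assumes "quantum_state d \<rho>"
  shows "hs_norm d \<rho> \<le> 1"
proof -
  have herm: "\<rho> i j = cnj (\<rho> j i)" if "i < d" "j < d" for i j
    using assms that unfolding quantum_state_def hermitian_def by blast
  have pos: "0 \<le> Re (qform d \<rho> v)" for v
    using assms by (simp add: quantum_state_def)
  have diag_real: "\<rho> i i = of_real (Re (\<rho> i i))" if "i < d" for i
    using arg_cong[OF herm[OF that that], of Im] by (simp add: complex_eq_iff)
  have diag_pos: "0 \<le> Re (\<rho> i i)" if "i < d" for i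
  proof -
    have "qform d \<rho> (\<lambda>k. if k = i then 1 else 0)
        = (\<Sum>k<d. \<Sum>l<d. if l = i then (if k = i then \<rho> i i else 0) else 0)"
      unfolding qform_def by (intro sum.cong refl) auto
    also have "\<dots> = \<rho> i i" using that by simp
    finally show ?thesis using pos by metis
  qed
  have minor: "(cmod (\<rho> i j))\<^sup>2 \<le> Re (\<rho> i i) * Re (\<rho> j j)" if ij: "i < d" "j < d" for i j
  proof (cases "i = j")
    case True
    then show ?thesis
      using diag_real[OF ij(1)] diag_pos[OF ij(1)]
      by (metis abs_of_nonneg norm_of_real order_refl power2_eq_square)
  next
    case False
    \<comment> \<open>Positivity on \<open>t e\<^sub>i - cnj (\<rho> i j) e\<^sub>j\<close>, then minimise over \<open>t\<close>.\<close>
    define q where "q = (cmod (\<rho> i j))\<^sup>2"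
    have quad: "0 \<le> t\<^sup>2 * Re (\<rho> i i) - 2 * t * q + q * Re (\<rho> j j)" for t :: real
    proof -
      define v where "v k = (if k = i then of_real t else if k = j then - cnj (\<rho> i j) else 0)" for k
      have "qform d \<rho> v = cnj (v i) * \<rho> i i * v i + cnj (v i) * \<rho> i j * v j
          + cnj (v j) * \<rho> j i * v i + cnj (v j) * \<rho> j j * v j"
        unfolding qform_def using False ij by (intro double_sum_two_point) (auto simp: v_def)
      also have "\<dots> = of_real (t\<^sup>2) * \<rho> i i - of_real t * (\<rho> i j * cnj (\<rho> i j))
          - of_real t * (\<rho> i j * cnj (\<rho> i j)) + (\<rho> i j * cnj (\<rho> i j)) * \<rho> j j"
        using False by (simp add: v_def herm[OF ij(2,1)] power2_eq_square mult_ac)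
      also have "\<rho> i j * cnj (\<rho> i j) = of_real q"
        unfolding q_def by (rule complex_norm_square[symmetric])
      finally have "qform d \<rho> v = of_real (t\<^sup>2) * \<rho> i i - of_real t * of_real q
          - of_real t * of_real q + of_real q * \<rho> j j" .
      then have "Re (qform d \<rho> v) = t\<^sup>2 * Re (\<rho> i i) - 2 * t * q + q * Re (\<rho> j j)"
        by (simp flip: of_real_power)
      then show ?thesis using pos[of v] by simp
    qed
    have q0: "0 \<le> q" by (simp add: q_def)
    show ?thesis
    proof (cases "q = 0")
      case True
      then show ?thesis using diag_pos ij by (simp add: q_def)
    next
      case q: False
      show ?thesis
      proof (cases "Re (\<rho> i i) = 0")
        case True
        \<comment> \<open>With a zero diagonal entry the polynomial is linear in \<open>t\<close>
          with slope \<open>- 2 * q\<close>. The chosen \<open>t\<close> lies one unit beyond its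
          root, where the value is \<open>- 2 * q\<close>.\<close>
        have "0 \<le> q * (- 2)" using quad[of "Re (\<rho> j j) / 2 + 1"] True
          by (simp add: algebra_simps)
        then show ?thesis using q q0 by simp
      next
        case False
        then have p: "Re (\<rho> i i) > 0" using diag_pos[OF ij(1)] by simp
        have "0 \<le> q * (Re (\<rho> j j) - q / Re (\<rho> i i))"
          using quad[of "q / Re (\<rho> i i)"] p by (simp add: field_simps power2_eq_square)
        then have "0 \<le> Re (\<rho> j j) - q / Re (\<rho> i i)"
          using q q0 by (simp add: zero_le_mult_iff)
        then show ?thesis using p by (simp add: q_def field_simps)
      qed
    qed
  qed
  have "(hs_norm d \<rho>)\<^sup>2 \<le> (\<Sum>i<d. \<Sum>j<d. Re (\<rho> i i) * Re (\<rho> j j))"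
    unfolding hs_norm_power2 by (intro sum_mono minor) auto
  also have "\<dots> = (Re (\<Sum>i<d. \<rho> i i))\<^sup>2"
    by (simp add: power2_eq_square sum_product)
  also have "\<dots> = 1\<^sup>2" using assms by (simp add: quantum_state_def)
  finally show ?thesis by (rule power2_le_imp_le) simp
qed

section \<open>Hermitian forms and the traceless part\<close>

lemma hermitian_qform_real:
  assumes "hermitian d A"
  shows "qform d A v = of_real (Re (qform d A v))"
proof -
  have "cnj (qform d A v) = (\<Sum>i<d. \<Sum>j<d. cnj (v j) * A j i * v i)"
    unfolding qform_def cnj_sum
  proof (intro sum.cong refl)
    fix i j assume "i \<in> {..<d}" "j \<in> {..<d}"
    then have "cnj (A i j) = A j i"
      using assms by (metis hermitian_def lessThan_iff)
    then show "cnj (cnj (v i) * A i j * v j) = cnj (v j) * A j i * v i" by simp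
  qed
  also have "\<dots> = qform d A v"
    unfolding qform_def by (rule sum.swap)
  finally show ?thesis
    by (metis Reals_cnj_iff of_real_Re)
qed

text \<open>For \<open>d > 0\<close> this is the orthogonal projection onto trace-zero matrices in
  the Hilbert-Schmidt inner product.\<close>

definition traceless_part :: "nat \<Rightarrow> (nat \<Rightarrow> nat \<Rightarrow> complex) \<Rightarrow> nat \<Rightarrow> nat \<Rightarrow> complex" where
  "traceless_part d A = (\<lambda>i j. A i j - (if i = j then mat_trace d A / of_nat d else 0))"

lemma mat_trace_traceless_part: "d > 0 \<Longrightarrow> mat_trace d (traceless_part d A) = 0"
  by (simp add: mat_trace_def traceless_part_def sum_subtractf)

lemma hermitian_traceless_part:
  assumes "hermitian d A"
  shows "hermitian d (traceless_part d A)"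
proof -
  have "cnj (mat_trace d A) = mat_trace d A"
    unfolding mat_trace_def cnj_sum
    using assms by (intro sum.cong refl) (metis hermitian_def lessThan_iff)
  then have t: "cnj (mat_trace d A / of_nat d) = mat_trace d A / of_nat d"
    by simp
  show ?thesis
    unfolding hermitian_def
  proof (intro allI impI)
    fix i j assume "i < d" "j < d"
    then have "cnj (A j i) = A i j"
      using assms by (metis hermitian_def)
    then show "traceless_part d A i j = cnj (traceless_part d A j i)"
      unfolding traceless_part_def complex_cnj_diff using t[symmetric] by simp
  qed
qed

text \<open>Pythagoras: removing the multiple \<open>t\<close> of the identity lowers the squared
  norm by exactly \<open>real d * (cmod t)\<^sup>2\<close>.\<close>

lemma hs_norm_traceless_part_le:
  assumes "d > 0"
  shows "hs_norm d (traceless_part d A) \<le> hs_norm d A"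
proof -
  define t where "t = mat_trace d A / of_nat d"
  have tr: "(\<Sum>i<d. A i i) = of_nat d * t"
    using assms by (simp add: t_def mat_trace_def)
  have sq: "(cmod (x - t))\<^sup>2 = (cmod x)\<^sup>2 - 2 * Re (cnj t * x) + (cmod t)\<^sup>2" for x
    unfolding cmod_power2 by (simp add: power2_eq_square algebra_simps)
  have "(\<Sum>i<d. \<Sum>j<d. (cmod (traceless_part d A i j))\<^sup>2)
      = (\<Sum>i<d. \<Sum>j<d. (cmod (A i j))\<^sup>2 + (if j = i then (cmod t)\<^sup>2 - 2 * Re (cnj t * A i i) else 0))"
    by (intro sum.cong refl) (simp add: traceless_part_def sq flip: t_def)
  also have "\<dots> = (\<Sum>i<d. \<Sum>j<d. (cmod (A i j))\<^sup>2) + (\<Sum>i<d. (cmod t)\<^sup>2 - 2 * Re (cnj t * A i i))"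
    by (simp add: sum.distrib)
  also have "(\<Sum>i<d. (cmod t)\<^sup>2 - 2 * Re (cnj t * A i i))
      = real d * (cmod t)\<^sup>2 - 2 * Re (cnj t * (\<Sum>i<d. A i i))"
    by (simp only: sum_subtractf sum_distrib_left Re_sum) simp
  also have "\<dots> = - (real d * (cmod t)\<^sup>2)"
    unfolding tr cmod_power2 by (simp add: power2_eq_square algebra_simps)
  finally show ?thesis
    unfolding hs_norm_def by (intro real_sqrt_le_mono) simp
qed

text \<open>The form of the identity matrix is constantly one on the sphere.\<close>

lemma qform_traceless_part:
  assumes "v \<in> unit_sphere d"
  shows "qform d A v = qform d (traceless_part d A) v + mat_trace d A / of_nat d"
proof -
  define t where "t = mat_trace d A / of_nat d"
  have v: "(\<Sum>i<d. v i * cnj (v i)) = 1"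
    using assms by (intro sum_mult_cnj_eq_1) (simp add: unit_sphere_def)
  have "qform d A v = (\<Sum>i<d. \<Sum>j<d. cnj (v i) * traceless_part d A i j * v j
      + (if j = i then t * (v i * cnj (v i)) else 0))"
    unfolding qform_def by (intro sum.cong refl) (simp add: traceless_part_def algebra_simps flip: t_def)
  also have "\<dots> = qform d (traceless_part d A) v + t * (\<Sum>i<d. v i * cnj (v i))"
    by (simp add: sum.distrib qform_def sum_distrib_left)
  finally show ?thesis by (simp add: v t_def)
qed

section \<open>Estimates for rising factorials and factorials\<close>

lemma power_le_pochhammer: "(x::real) ^ n \<le> pochhammer x n" if "x \<ge> 0"
proof (induction n)
  case (Suc n)
  have "x ^ n * x \<le> pochhammer x n * (x + of_nat n)"
    using that Suc by (intro mult_mono) (auto intro: order_trans[OF zero_le_power])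
  then show ?case by (simp add: pochhammer_Suc mult.commute)
qed simp

text \<open>Dropping the factor 1 of the factorial leaves \<open>n\<close> factors. With exponent
  \<open>n\<close> instead of \<open>Suc n\<close>, \<open>fact (Suc h)\<close> can be absorbed into
  an \<open>h\<close>-th power.\<close>

lemma fact_Suc_le_power: "fact (Suc n) \<le> (real (Suc n)) ^ n"
proof (induction n)
  case (Suc n)
  have "fact (Suc (Suc n)) = real (Suc (Suc n)) * fact (Suc n)"
    by (rule fact_Suc)
  also have "\<dots> \<le> real (Suc (Suc n)) * real (Suc (Suc n)) ^ n"
    by (intro mult_left_mono order_trans[OF Suc] power_mono) auto
  finally show ?case by simp
qed simp

section \<open>Factorial bounds for mixed moments\<close>

context haar_sphere_measure
begin

lemma moment_0: "moment 0 A = 1"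
  by (simp add: moment_def prob_space)

text \<open>Induction along \<open>moment_Suc\<close>. Merging factors \<open>k\<close> and
  \<open>n\<close> changes the weight of slot \<open>k\<close> to \<open>w k * w n\<close>, so
  \<open>A\<close> and \<open>w\<close> must be generalised. The trace term and the \<open>n\<close>
  merged terms then share the bound \<open>w n * b\<close>, and their number \<open>Suc n\<close>
  builds up the factorial.\<close>

lemma cmod_moment_le:
  assumes "\<And>l. l < n \<Longrightarrow> trace_hs_le d (A l) (w l)"
  shows "cmod (moment n A) \<le> fact n / pochhammer (real d) n * (\<Prod>l<n. w l)"
  using assms
proof (induction n arbitrary: A w)
  case 0
  then show ?case by (simp add: moment_0)
next
  case (Suc n)
  define b where "b = fact n / pochhammer (real d) n * (\<Prod>l<n. w l)"
  have w: "0 \<le> w l" if "l < Suc n" for l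
    using Suc.prems[OF that] by (rule trace_hs_le_nonneg)
  have "real (d + n) * cmod (moment (Suc n) A) = cmod (of_nat (d + n) * moment (Suc n) A)"
    by (simp only: norm_mult norm_of_nat)
  also have "\<dots> \<le> cmod (mat_trace d (A n)) * cmod (moment n A)
      + (\<Sum>k<n. cmod (moment n (A(k := mat_mult d (A k) (A n)))))"
    unfolding moment_Suc by (intro order_trans[OF norm_triangle_ineq] add_mono norm_sum) (simp add: norm_mult)
  also have "\<dots> \<le> w n * b + (\<Sum>k<n. w n * b)"
  proof (intro add_mono sum_mono mult_mono)
    show "cmod (mat_trace d (A n)) \<le> w n" using Suc.prems[of n] by (simp add: trace_hs_le_def)
    show "cmod (moment n A) \<le> b" unfolding b_def by (rule Suc.IH) (use Suc.prems in auto)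
    fix k assume "k \<in> {..<n}"
    then have k: "k < n" by simp
    have "cmod (moment n (A(k := mat_mult d (A k) (A n))))
       \<le> fact n / pochhammer (real d) n * (\<Prod>l<n. (w(k := w k * w n)) l)"
      using k by (intro Suc.IH) (auto intro!: trace_hs_le_mat_mult Suc.prems)
    also have "(\<Prod>l<n. (w(k := w k * w n)) l) = w n * (\<Prod>l<n. w l)"
    proof -
      have "(\<Prod>l\<in>{..<n} - {k}. (w(k := w k * w n)) l) = (\<Prod>l\<in>{..<n} - {k}. w l)"
        by (intro prod.cong) auto
      then show ?thesis
        using k by (simp add: prod.remove[of "{..<n}" k] mult_ac)
    qed
    finally show "cmod (moment n (A(k := mat_mult d (A k) (A n)))) \<le> w n * b"
      by (simp only: b_def mult_ac)
  qed (use w in auto)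
  also have "\<dots> = real (Suc n) * (w n * b)" by (simp add: algebra_simps)
  finally have "cmod (moment (Suc n) A) \<le> real (Suc n) * (w n * b) / real (d + n)"
    using dim_pos by (simp add: pos_le_divide_eq mult.commute)
  also have "\<dots> = fact (Suc n) / pochhammer (real d) (Suc n) * (\<Prod>l<Suc n. w l)"
    by (simp add: b_def pochhammer_Suc)
  finally show ?case .
qed

section \<open>Moments under the outcome distribution\<close>

text \<open>The density of the outcome distribution is itself a form, so a \<open>k\<close>-th
  moment becomes a mixed moment with \<open>\<rho>\<close> in slot \<open>k\<close>. All forms
  involved are real, which lets \<open>Re\<close> pass through the product.\<close>

lemma weighted_moment:
  assumes \<rho>: "quantum_state d \<rho>" and A: "hermitian d A"
  defines "N k \<equiv> (\<lambda>l. if l < k then A else \<rho>)"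
  shows "integrable \<mu> (\<lambda>v. real d * Re (qform d \<rho> v) * Re (qform d A v) ^ k)"
    and "(\<integral>v. real d * Re (qform d \<rho> v) * Re (qform d A v) ^ k \<partial>\<mu>) = real d * Re (moment (Suc k) (N k))"
proof -
  have sb: "sphere_bounded (\<lambda>v. \<Prod>l<Suc k. qform d (N k l) v)"
    by (intro sphere_bounded_intros)
  have eq: "real d * Re (qform d \<rho> v) * Re (qform d A v) ^ k = real d * Re (\<Prod>l<Suc k. qform d (N k l) v)" for v
  proof -
    have "(\<Prod>l<Suc k. qform d (N k l) v) = qform d A v ^ k * qform d \<rho> v"
      by (simp add: N_def)
    also have "\<dots> = of_real (Re (qform d A v)) ^ k * of_real (Re (qform d \<rho> v))"
      using hermitian_qform_real[OF A] hermitian_qform_real[of d \<rho>] \<rho>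
      by (metis quantum_state_def)
    also have "\<dots> = of_real (Re (qform d A v) ^ k * Re (qform d \<rho> v))"
      by simp
    finally show ?thesis by (simp only: Re_complex_of_real) simp
  qed
  from sphere_bounded_integrable[OF sb]
  show "integrable \<mu> (\<lambda>v. real d * Re (qform d \<rho> v) * Re (qform d A v) ^ k)"
    unfolding eq by (intro integrable_mult_right integrable_Re)
  from sphere_bounded_integrable[OF sb]
  show "(\<integral>v. real d * Re (qform d \<rho> v) * Re (qform d A v) ^ k \<partial>\<mu>) = real d * Re (moment (Suc k) (N k))"
    unfolding eq moment_def by (simp only: integral_mult_right_zero integral_Re)
qed

text \<open>Trace zero allows the weight \<open>hs_norm d A\<close> for \<open>A\<close>, which
  would otherwise have to dominate the trace as well. The state \<open>\<rho>\<close> has weight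
  1.\<close>

lemma weighted_moment_le:
  assumes \<rho>: "quantum_state d \<rho>" and A: "hermitian d A" "mat_trace d A = 0"
  shows "\<bar>\<integral>v. real d * Re (qform d \<rho> v) * Re (qform d A v) ^ k \<partial>\<mu>\<bar>
           \<le> fact (Suc k) * (hs_norm d A / (real d + 1)) ^ k"
proof -
  define N where "N = (\<lambda>l. if l < k then A else \<rho>)"
  have "cmod (moment (Suc k) N) \<le> fact (Suc k) / pochhammer (real d) (Suc k)
      * (\<Prod>l<Suc k. if l < k then hs_norm d A else 1)"
    using A(2) \<rho> quantum_state_hs_norm_le_1[OF \<rho>]
    by (intro cmod_moment_le)
      (auto simp: N_def trace_hs_le_def hs_norm_nonneg quantum_state_def mat_trace_def)
  also have "(\<Prod>l<Suc k. if l < k then hs_norm d A else 1) = hs_norm d A ^ k"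
    by simp
  finally have m: "cmod (moment (Suc k) N) \<le> fact (Suc k) / pochhammer (real d) (Suc k) * hs_norm d A ^ k" .
  have "\<bar>\<integral>v. real d * Re (qform d \<rho> v) * Re (qform d A v) ^ k \<partial>\<mu>\<bar> = real d * \<bar>Re (moment (Suc k) N)\<bar>"
    unfolding weighted_moment(2)[OF \<rho> A(1)] N_def by (simp add: abs_mult)
  also have "\<dots> \<le> real d * (fact (Suc k) / pochhammer (real d) (Suc k) * hs_norm d A ^ k)"
    by (intro mult_left_mono order_trans[OF abs_Re_le_cmod m]) auto
  \<comment> \<open>The factor \<open>d\<close> of the density cancels the first factor of the
    rising factorial; this is where the denominator \<open>d + 1\<close> comes from.\<close>
  also have "\<dots> = fact (Suc k) * hs_norm d A ^ k / pochhammer (real d + 1) k"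
    using dim_pos by (simp add: pochhammer_rec)
  also have "\<dots> \<le> fact (Suc k) * hs_norm d A ^ k / (real d + 1) ^ k"
    by (intro divide_left_mono power_le_pochhammer mult_nonneg_nonneg mult_pos_pos pochhammer_pos)
      (auto simp: hs_norm_nonneg)
  finally show ?thesis by (simp add: power_divide)
qed

section \<open>Centred moments\<close>

text \<open>The constant is \<open>6 = 2 * 3\<close>: the 3 comes from the binomial sum of
  \<open>M\<close> and \<open>2 * M\<close>, the 2 from absorbing \<open>fact (Suc h)\<close> into
  \<open>(2 * real h) ^ h\<close>.\<close>

lemma centered_moment_le:
  assumes \<rho>: "quantum_state d \<rho>" and A: "hermitian d A" and h: "h \<ge> 1"
  defines "D \<equiv> povm_dist d \<mu> \<rho>"
  shows "(\<integral>v. (Re (qform d A v) - (\<integral>v. Re (qform d A v) \<partial>D)) ^ h \<partial>D)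
           \<le> (6 * real h * hs_norm d A / (real d + 1)) ^ h"
proof -
  define w where "w v = real d * Re (qform d \<rho> v)" for v
  define B where "B = traceless_part d A"
  define Y where "Y v = Re (qform d B v)" for v
  define \<tau> where "\<tau> = Re (mat_trace d A / of_nat d)"
  define E where "E k = (\<integral>v. w v * Y v ^ k \<partial>\<mu>)" for k
  define M where "M = hs_norm d A / (real d + 1)"
  have B: "hermitian d B" "mat_trace d B = 0"
    using hermitian_traceless_part[OF A] mat_trace_traceless_part[OF dim_pos] by (simp_all add: B_def)
  have [measurable]: "qform d C \<in> borel_measurable \<mu>" for C
    by (intro sphere_boundedD_measurable sphere_bounded_qform)
  have [measurable]: "w \<in> borel_measurable \<mu>" "Y \<in> borel_measurable \<mu>"
    unfolding w_def[abs_def] Y_def[abs_def] by measurable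
  have w_nonneg: "0 \<le> w v" for v
    using \<rho> by (simp add: w_def quantum_state_def)
  have D: "(\<integral>v. f v \<partial>D) = (\<integral>v. w v * f v \<partial>\<mu>)" if "f \<in> borel_measurable \<mu>" for f :: "_ \<Rightarrow> real"
    unfolding D_def povm_dist_def using that w_nonneg
    by (subst integral_density) (auto simp: w_def)
  have int: "integrable \<mu> (\<lambda>v. w v * Y v ^ k)" for k
    using weighted_moment(1)[OF \<rho> B(1)] by (simp add: w_def Y_def)
  \<comment> \<open>The outcome distribution has total mass one: the recursion with no earlier
    factor equates \<open>d\<close> times the first moment of \<open>\<rho>\<close> with its
    trace.\<close>
  have E0: "E 0 = 1"
  proof -
    have "real d * Re (moment (Suc 0) (\<lambda>l. \<rho>)) = Re (of_nat (d + 0) * moment (Suc 0) (\<lambda>l. \<rho>))"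
      by simp
    also have "\<dots> = 1"
      unfolding moment_Suc moment_0 using \<rho> by (simp add: quantum_state_def mat_trace_def)
    finally show ?thesis
      unfolding E_def w_def Y_def weighted_moment(2)[OF \<rho> B(1)] by simp
  qed
  have M_nonneg: "0 \<le> M" by (simp add: M_def hs_norm_nonneg)
  have E_le: "\<bar>E k\<bar> \<le> fact (Suc k) * M ^ k" for k
  proof -
    have "\<bar>E k\<bar> \<le> fact (Suc k) * (hs_norm d B / (real d + 1)) ^ k"
      unfolding E_def w_def Y_def by (rule weighted_moment_le[OF \<rho> B])
    also have "\<dots> \<le> fact (Suc k) * M ^ k"
      unfolding M_def B_def
      by (intro mult_left_mono power_mono divide_right_mono hs_norm_traceless_part_le[OF dim_pos])
        (auto simp: hs_norm_nonneg)
    finally show ?thesis .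
  qed
  \<comment> \<open>Centring cancels the constant \<open>\<tau>\<close>, so the centred variable is
    \<open>Y v - E 1\<close> and only moments of the traceless part matter.\<close>
  have X: "AE v in \<mu>. Re (qform d A v) = Y v + \<tau>"
    using AE_unit_sphere by eventually_elim (simp add: qform_traceless_part[of _ d A] Y_def B_def \<tau>_def)
  have "(\<integral>v. Re (qform d A v) \<partial>D) = (\<integral>v. w v * Y v ^ 1 + \<tau> * (w v * Y v ^ 0) \<partial>\<mu>)"
    using X by (subst D) (auto intro!: integral_cong_AE simp: algebra_simps elim!: eventually_mono)
  also have "\<dots> = E 1 + \<tau>"
    using int[of 1] int[of 0] E0 by (simp add: E_def)
  finally have m: "(\<integral>v. Re (qform d A v) \<partial>D) = E 1 + \<tau>" .
  have "(\<integral>v. (Re (qform d A v) - (\<integral>v. Re (qform d A v) \<partial>D)) ^ h \<partial>D) = (\<integral>v. w v * (Y v + - E 1) ^ h \<partial>\<mu>)"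
    unfolding m using X by (subst D) (auto intro!: integral_cong_AE elim!: eventually_mono)
  also have "\<dots> = (\<integral>v. (\<Sum>k\<le>h. (real (h choose k) * (- E 1) ^ (h - k)) * (w v * Y v ^ k)) \<partial>\<mu>)"
    by (simp only: binomial_ring sum_distrib_left) (simp add: mult_ac)
  also have "\<dots> = (\<Sum>k\<le>h. (real (h choose k) * (- E 1) ^ (h - k)) * E k)"
    using int by (simp add: E_def)
  \<comment> \<open>The mean satisfies \<open>\<bar>E 1\<bar> \<le> 2 * M\<close> because
    \<open>fact (Suc 1) = 2\<close>. Replacing every \<open>fact (Suc k)\<close> by the largest one
    makes the sum binomial again.\<close>
  also have "\<dots> \<le> (\<Sum>k\<le>h. fact (Suc h) * (real (h choose k) * M ^ k * (2 * M) ^ (h - k)))"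
  proof (intro sum_mono)
    fix k assume "k \<in> {..h}"
    then have k: "k \<le> h" by simp
    have "(real (h choose k) * (- E 1) ^ (h - k)) * E k \<le> \<bar>(real (h choose k) * (- E 1) ^ (h - k)) * E k\<bar>"
      by (rule abs_ge_self)
    also have "\<dots> = real (h choose k) * \<bar>E 1\<bar> ^ (h - k) * \<bar>E k\<bar>"
      by (simp add: abs_mult power_abs)
    also have "\<dots> \<le> real (h choose k) * (2 * M) ^ (h - k) * (fact (Suc h) * M ^ k)"
    proof (intro mult_mono power_mono)
      show "\<bar>E 1\<bar> \<le> 2 * M" using E_le[of 1] by simp
      have "fact (Suc k) * M ^ k \<le> fact (Suc h) * M ^ k"
        using k M_nonneg by (intro mult_right_mono fact_mono) auto
      then show "\<bar>E k\<bar> \<le> fact (Suc h) * M ^ k" using E_le[of k] by linarith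
    qed (use M_nonneg in auto)
    finally show "(real (h choose k) * (- E 1) ^ (h - k)) * E k
        \<le> fact (Suc h) * (real (h choose k) * M ^ k * (2 * M) ^ (h - k))"
      by (simp only: mult_ac)
  qed
  also have "\<dots> = fact (Suc h) * (M + 2 * M) ^ h"
    by (simp only: binomial_ring sum_distrib_left)
  \<comment> \<open>Uses \<open>fact (Suc h) \<le> real (Suc h) ^ h\<close> and
    \<open>Suc h \<le> 2 * h\<close>, valid for \<open>h \<ge> 1\<close>.\<close>
  also have "\<dots> \<le> (2 * real h) ^ h * (M + 2 * M) ^ h"
    using M_nonneg h
    by (intro mult_right_mono order_trans[OF fact_Suc_le_power] power_mono) auto
  also have "\<dots> = (6 * real h * hs_norm d A / (real d + 1)) ^ h"
  proof -
    have "2 * real h * (M + 2 * M) = 6 * real h * hs_norm d A / (real d + 1)"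
      by (simp add: M_def)
    then show ?thesis by (simp only: power_mult_distrib[symmetric])
  qed
  finally show ?thesis .
qed

end

theorem theorem6:
  shows "\<exists>C::real. \<forall>(d::nat) \<mu> \<rho> A (h::nat).
     haar_sphere d \<mu> \<and> quantum_state d \<rho> \<and> hermitian d A \<and> h \<ge> 2 \<longrightarrow>
     (let D = povm_dist d \<mu> \<rho>;
          m = (\<integral>v. Re (qform d A v) \<partial>D)
      in (\<integral>v. (Re (qform d A v) - m) ^ h \<partial>D)
         \<le> (C * real h * hs_norm d A / (real d + 1)) ^ h)"
  unfolding Let_def
  by (intro exI[of _ 6] allI impI haar_sphere_measure.centered_moment_le)
    (auto intro: haar_sphere_measure.intro)

end
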